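(* Consider a finite discounted MDP and let $\bar\rho$ be the joint spectral radius of the restricted family $\{\bar A_\pi:\pi\in\Theta\}$. The following statements are equivalent: 1. $\bar\rho<\gamma$. 2. There exists an integer $L\ge1$ such that, for every deterministic policy sequence $\omega=(\pi_0,\dots,\pi_{L-1})\in\Theta^L$, the product $B_\omega:=B_{\pi_{L-1}}\cdots B_{\pi_1}B_{\pi_0}$ is scrambling. 3. There exists an integer $L\ge1$ such that $\max_{\omega\in\Theta^L}\tau_{\rm D}(B_\omega)<1$. 4. There exists an integer $L\ge1$ such that $\sup_{\mu_0,\dots,\mu_{L-1}}\tau_{\rm D}(B_{\mu_{L-1}}\cdots B_{\mu_1}B_{\mu_0})<1$, where the supremum is over all stochastic policies $\mu_0,\dots,\mu_{L-1}:\mathcal S\to\Delta_{|\mathcal A|}$. Moreover, if these equivalent conditions hold, with $L$ an integer as in condition 2, and $$\eta_L:=\min_{\omega\in\Theta^L}\ \min_{x,y\in\mathcal Y}\ \sum_{\upsilon\in\mathcal Y}\min\{(B_\omega)_{x\upsilon},(B_\omega)_{y\upsilon}\},$$ then $\eta_L>0$ and $$\bar\rho\le\gamma(1-\eta_L)^{1/L}<\gamma.$$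
   Context: Finite discounted MDP: finite nonempty state set $\mathcal S$ and action set $\mathcal A$, transition probabilities $P(s'|s,a)$, discount $\gamma\in(0,1)$. Put $\mathcal Y:=\mathcal S\times\mathcal A$, $n=|\mathcal Y|$. $P$ also denotes the $n\times|\mathcal S|$ matrix with entry $P(s'|s,a)$ in row $(s,a)$, column $s'$. For a stochastic policy $\mu$ (a map $\mathcal S\to\Delta_{|\mathcal A|}$, the probability simplex over $\mathcal A$), $\Pi^\mu$ is the $|\mathcal S|\times n$ matrix with $(\Pi^\mu Q)(s)=\sum_a\mu(a|s)Q(s,a)$; a deterministic policy $\pi:\mathcal S\to\mathcal A$ is identified with its one-hot stochastic policy. $\Theta$ is the (finite) set of all deterministic policies. $B_\mu:=P\Pi^\mu$, a row-stochastic $n\times n$ matrix indexed by $\mathcal Y$. $\mathbf\Pi_\perp:=I-\frac1n\mathbf 1\mathbf 1^\top$ with $\mathbf 1\in\mathbb R^n$ the all-ones vector, $A_\pi:=\gamma P\Pi^\pi=\gamma B_\pi$, $\bar A_\pi:=\mathbf\Pi_\perp A_\pi\mathbf\Pi_\perp$. Joint spectral radius of a finite set of matrices: $\rho(M_1,\dots,M_m)=\lim_{k\to\infty}\max_{\sigma\in\{1,\dots,m\}^k}\|M_{\sigma_k}\cdots M_{\sigma_1}\|^{1/k}$ (any submultiplicative norm). A row-stochastic matrix $B$ indexed by $\mathcal Y$ is scrambling if for every $x,y\in\mathcal Y$ there is $\upsilon\in\mathcal Y$ with $B_{x\upsilon}>0$ and $B_{y\upsilon}>0$. Its Dobrushin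 coefficient is $\tau_{\rm D}(B):=\frac12\max_{x,y\in\mathcal Y}\sum_{\upsilon\in\mathcal Y}|B_{x\upsilon}-B_{y\upsilon}|$. *)

theory Defs
  imports "HOL-Analysis.Analysis"
begin

definition row_stochastic :: "real^'m^'n \<Rightarrow> bool" where
  "row_stochastic M \<longleftrightarrow> (\<forall>i j. 0 \<le> M $ i $ j) \<and> (\<forall>i. (\<Sum>j\<in>UNIV. M $ i $ j) = 1)"

(* The head of the list is the rightmost factor: [M0, M1, M2] gives M2 ** M1 ** M0. *)
primrec mat_prod :: "(real^'n^'n) list \<Rightarrow> real^'n^'n" where
  "mat_prod [] = mat 1"
| "mat_prod (M # Ms) = mat_prod Ms ** M"

(* The norm is the operator norm induced by the Euclidean norm; every submultiplicative norm
   gives the same limit.  The limit exists for every finite nonempty F (Fekete). *)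
definition joint_spectral_radius :: "(real^'n^'n) set \<Rightarrow> real" where
  "joint_spectral_radius F =
     lim (\<lambda>k. Max {root k (onorm ((*v) (mat_prod Ms))) | Ms. length Ms = k \<and> set Ms \<subseteq> F})"

definition centering :: "real^'n^'n" where
  "centering = mat 1 - (1 / real CARD('n)) *\<^sub>R (\<chi> i j. 1)"

definition scrambling :: "real^'n^'n \<Rightarrow> bool" where
  "scrambling B \<longleftrightarrow> (\<forall>x y. \<exists>v. 0 < B $ x $ v \<and> 0 < B $ y $ v)"

definition dobrushin :: "real^'n^'n \<Rightarrow> real" where
  "dobrushin B = 1/2 * Max {\<Sum>v\<in>UNIV. \<bar>B $ x $ v - B $ y $ v\<bar> | x y. True}"

definition stochastic_policy :: "('s \<Rightarrow> 'a::finite \<Rightarrow> real) \<Rightarrow> bool" where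
  "stochastic_policy \<mu> \<longleftrightarrow> (\<forall>s. (\<forall>a. 0 \<le> \<mu> s a) \<and> (\<Sum>a\<in>UNIV. \<mu> s a) = 1)"

definition one_hot :: "('s \<Rightarrow> 'a) \<Rightarrow> 's \<Rightarrow> 'a \<Rightarrow> real" where
  "one_hot \<pi> s a = (if a = \<pi> s then 1 else 0)"

definition policy_mat :: "('s \<Rightarrow> 'a \<Rightarrow> real) \<Rightarrow> real^('s::finite \<times> 'a::finite)^'s" where
  "policy_mat \<mu> = (\<chi> s y. if fst y = s then \<mu> s (snd y) else 0)"

lemma policy_mat_mult_vec: "(policy_mat \<mu> *v Q) $ s = (\<Sum>a\<in>UNIV. \<mu> s a * Q $ (s, a))"
proof -
  have "(policy_mat \<mu> *v Q) $ s
      = (\<Sum>s'\<in>UNIV. \<Sum>a\<in>UNIV. (if s' = s then \<mu> s a else 0) * Q $ (s', a))"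
    by (simp add: policy_mat_def matrix_vector_mult_def sum.cartesian_product
        case_prod_beta UNIV_Times_UNIV)
  also have "\<dots> = (\<Sum>s'\<in>UNIV. if s' = s then \<Sum>a\<in>UNIV. \<mu> s a * Q $ (s, a) else 0)"
    by (intro sum.cong) auto
  finally show ?thesis by simp
qed

(* P has row index (s,a), column index s', and entry P(s'|s,a). *)
definition sa_kernel ::
  "real^'s^('s::finite \<times> 'a::finite) \<Rightarrow> ('s \<Rightarrow> 'a \<Rightarrow> real) \<Rightarrow> real^('s \<times> 'a)^('s \<times> 'a)" where
  "sa_kernel P \<mu> = P ** policy_mat \<mu>"

definition kernel_prod ::
  "real^'s^('s::finite \<times> 'a::finite) \<Rightarrow> ('s \<Rightarrow> 'a \<Rightarrow> real) list \<Rightarrow> real^('s \<times> 'a)^('s \<times> 'a)" where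
  "kernel_prod P \<mu>s = mat_prod (map (sa_kernel P) \<mu>s)"

definition det_kernel_prod ::
  "real^'s^('s::finite \<times> 'a::finite) \<Rightarrow> ('s \<Rightarrow> 'a) list \<Rightarrow> real^('s \<times> 'a)^('s \<times> 'a)" where
  "det_kernel_prod P \<omega> = kernel_prod P (map one_hot \<omega>)"

definition restricted_mat ::
  "real^'s^('s::finite \<times> 'a::finite) \<Rightarrow> real \<Rightarrow> ('s \<Rightarrow> 'a) \<Rightarrow> real^('s \<times> 'a)^('s \<times> 'a)" where
  "restricted_mat P \<gamma> \<pi> = centering ** (\<gamma> *\<^sub>R sa_kernel P (one_hot \<pi>)) ** centering"

definition rho_bar :: "real^'s^('s::finite \<times> 'a::finite) \<Rightarrow> real \<Rightarrow> real" where
  "rho_bar P \<gamma> = joint_spectral_radius (range (restricted_mat P \<gamma>))"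

definition overlap :: "real^'n^'n \<Rightarrow> real" where
  "overlap B = Min {\<Sum>v\<in>UNIV. min (B $ x $ v) (B $ y $ v) | x y. True}"

definition eta :: "real^'s^('s::finite \<times> 'a::finite) \<Rightarrow> nat \<Rightarrow> real" where
  "eta P L = Min {overlap (det_kernel_prod P \<omega>) | \<omega>. length \<omega> = L}"

end

theory Submission
  imports Defs
begin

text \<open>Centering kills constant rows, so a product of restricted matrices is the discounted kernel
  product, centered once on the left, and its norm is comparable to the Dobrushin coefficient of
  the kernel product. That coefficient is submultiplicative and equals one minus the overlap, so
  the joint spectral radius is below the discount factor exactly when the coefficients of all long
  enough products are below 1. It is also convex, and products of stochastic policies are convex
  combinations of products of deterministic ones.\<close>

text \<open>Comparing the norm of a centered product with the Dobrushin coefficient of the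
  uncentered one costs constants that depend only on the number n of state-action pairs. Under the
  k-th root they tend to 1, so both quantities have the same exponential rate up to the factor
  \<gamma>. Hence a single length with all coefficients below 1 already bounds the radius, and a
  radius strictly below \<gamma> leaves a geometric gap that beats n at some length. Two obstacles
  shape the rest. \<open>joint_spectral_radius\<close> is a \<open>lim\<close>, which carries
  information only once convergence is known; this calls for Fekete's argument. And the stochastic
  policies form an infinite set, over which pointwise strict inequalities need not survive a
  supremum; convexity identifies that supremum with a maximum over finitely many deterministic words
  of the same length.\<close>

section \<open>Submultiplicative sequences and Fekete's lemma\<close>

lemma submultiplicative_block_bound:
  fixes u :: "nat \<Rightarrow> real"
  assumes nonneg: "\<And>k. 0 \<le> u k" and submult: "\<And>m n. u (m + n) \<le> u m * u n"
  shows "u (L * q + r) \<le> u L ^ q * u r"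
proof (induction q)
  case (Suc q)
  have "u (L * Suc q + r) \<le> u L * u (L * q + r)"
    using submult[of L "L * q + r"] by (simp add: algebra_simps)
  also have "\<dots> \<le> u L * (u L ^ q * u r)"
    by (intro mult_left_mono Suc.IH nonneg)
  finally show ?case by (simp add: mult.assoc)
qed simp

text \<open>Divide k by L with remainder: each full block costs at most \<open>c ^ L\<close>, and
  the remainder takes only finitely many values, so it costs a constant factor. The bound keeps that
  factor as \<open>root k K\<close>, which tends to 1.\<close>

lemma submultiplicative_root_bound:
  fixes u :: "nat \<Rightarrow> real"
  assumes nonneg: "\<And>k. 0 \<le> u k" and submult: "\<And>m n. u (m + n) \<le> u m * u n"
    and L: "L \<ge> 1" and c: "0 < c" "root L (u L) \<le> c"
  obtains K where "K > 0" "\<And>k. k \<ge> 1 \<Longrightarrow> root k (u k) \<le> c * root k K"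
proof
  \<comment> \<open>The sum dominates \<open>u r / c ^ r\<close> for all remainders at once; the
    added 1 makes \<open>K\<close> positive.\<close>
  define K where "K = 1 + (\<Sum>r<L. u r / c ^ r)"
  have uL: "u L \<le> c ^ L"
  proof -
    have "root L (u L) ^ L \<le> c ^ L"
      using L nonneg[of L] c by (intro power_mono) auto
    then show ?thesis using L nonneg[of L] by simp
  qed
  show K: "K > 0"
    unfolding K_def using nonneg c by (intro add_pos_nonneg sum_nonneg) auto
  fix k :: nat assume k: "k \<ge> 1"
  define q r where "q = k div L" and "r = k mod L"
  have k_eq: "k = L * q + r" by (simp add: q_def r_def)
  have r: "r < L" using L by (simp add: r_def)
  have "u r / c ^ r \<le> (\<Sum>r<L. u r / c ^ r)"
    using r nonneg c by (intro member_le_sum) auto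
  then have "u r / c ^ r \<le> K" by (simp add: K_def)
  then have ur: "u r \<le> c ^ r * K"
    using c by (simp add: field_simps)
  have "u k \<le> u L ^ q * u r"
    unfolding k_eq by (rule submultiplicative_block_bound[OF nonneg submult])
  also have "\<dots> \<le> (c ^ L) ^ q * (c ^ r * K)"
    using uL ur nonneg c K by (intro mult_mono power_mono) auto
  also have "\<dots> = c ^ k * K"
    by (simp add: k_eq power_add power_mult)
  finally have "root k (u k) \<le> root k (c ^ k * K)" using k by simp
  also have "\<dots> = c * root k K"
    using k c by (simp add: real_root_mult real_root_power_cancel)
  finally show "root k (u k) \<le> c * root k K" .
qed

text \<open>Fekete's lemma in multiplicative form: the limit is the infimum of the roots.\<close>

lemma submultiplicative_root_convergent:
  fixes u :: "nat \<Rightarrow> real"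
  assumes nonneg: "\<And>k. 0 \<le> u k" and submult: "\<And>m n. u (m + n) \<le> u m * u n"
  shows "convergent (\<lambda>k. root k (u k))"
proof -
  \<comment> \<open>Index 0 is left out because \<open>root 0 x\<close> is 0 and would spoil the
    infimum.\<close>
  define S where "S = (\<lambda>k. root k (u k)) ` {1..}"
  have bdd: "bdd_below S" and ne: "S \<noteq> {}"
    using nonneg by (auto simp: S_def intro!: bdd_belowI[of _ 0])
  have Inf_le: "Inf S \<le> root k (u k)" if "k \<ge> 1" for k
    using that by (intro cInf_lower bdd) (auto simp: S_def)
  have Inf_nonneg: "0 \<le> Inf S"
    using ne nonneg by (intro cInf_greatest) (auto simp: S_def)
  have "(\<lambda>k. root k (u k)) \<longlonglongrightarrow> Inf S"
  proof (rule order_tendstoI)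
    fix a assume "a < Inf S"
    then have "a < root k (u k)" if "k \<ge> 1" for k using Inf_le[OF that] by simp
    then show "eventually (\<lambda>k. a < root k (u k)) sequentially"
      by (rule eventually_sequentiallyI)
  next
    fix a assume a: "Inf S < a"
    \<comment> \<open>The gap between \<open>b\<close> and \<open>a\<close> absorbs the factor
      \<open>root k K\<close>, which only tends to 1.\<close>
    then obtain b where b: "Inf S < b" "b < a" using dense by blast
    obtain L where L: "L \<ge> 1" "root L (u L) < b"
      using cInf_lessD[OF ne b(1)] by (auto simp: S_def)
    have "0 < b" using Inf_nonneg b by simp
    then obtain K where K: "K > 0" "\<And>k. k \<ge> 1 \<Longrightarrow> root k (u k) \<le> b * root k K"
      using submultiplicative_root_bound[OF nonneg submult L(1) _ less_imp_le[OF L(2)]] by metis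
    have "(\<lambda>k. b * root k K) \<longlonglongrightarrow> b * 1"
      by (intro tendsto_intros LIMSEQ_root_const K)
    then have "eventually (\<lambda>k. b * root k K < a) sequentially"
      using b by (intro order_tendstoD(2)) auto
    then show "eventually (\<lambda>k. root k (u k) < a) sequentially"
      using eventually_ge_at_top[of 1] by eventually_elim (use K(2) in fastforce)
  qed
  then show ?thesis by (rule convergentI)
qed

section \<open>The joint spectral radius as a limit of norms\<close>

lemma mat_prod_append: "mat_prod (Ms @ Ns) = mat_prod Ns ** mat_prod Ms"
  by (induction Ms) (auto simp: matrix_mul_assoc)

lemma onorm_matrix_mult_le:
  fixes A :: "real^'m^'n" and B :: "real^'k^'m"
  shows "onorm ((*v) (A ** B)) \<le> onorm ((*v) A) * onorm ((*v) B)"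
  using onorm_compose[of "(*v) A" "(*v) B"]
  by (simp add: o_def matrix_vector_mul_assoc matrix_vector_mul_bounded_linear)

lemma abs_component_le_onorm_matrix:
  fixes A :: "real^'m^'n"
  shows "\<bar>A $ i $ j\<bar> \<le> onorm ((*v) A)"
proof -
  have "\<bar>A $ i $ j\<bar> = \<bar>(A *v axis j 1) $ i\<bar>"
    by (simp add: matrix_vector_mult_basis column_def)
  also have "\<dots> \<le> norm (A *v axis j 1)" by (rule component_le_norm_cart)
  also have "\<dots> \<le> onorm ((*v) A) * norm (axis j (1::real) :: real^'m)"
    by (rule onorm[OF matrix_vector_mul_bounded_linear])
  finally show ?thesis by simp
qed

text \<open>The root is taken outside the maximum here, unlike in
  \<open>joint_spectral_radius\<close>, because submultiplicativity concerns the norms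
  themselves.\<close>

definition norm_growth :: "(real^'n^'n) set \<Rightarrow> nat \<Rightarrow> real" where
  "norm_growth F k = Max {onorm ((*v) (mat_prod Ms)) | Ms. length Ms = k \<and> set Ms \<subseteq> F}"

context
  fixes F :: "(real^'n^'n) set"
  assumes F: "finite F" "F \<noteq> {}"
begin

lemma finite_words: "finite {Ms. length Ms = k \<and> set Ms \<subseteq> F}"
  using finite_lists_length_eq[OF F(1), of k] by (simp add: conj_commute)

lemma words_nonempty: "{Ms. length Ms = k \<and> set Ms \<subseteq> F} \<noteq> {}"
proof -
  obtain M where "M \<in> F" using F(2) by blast
  then have "replicate k M \<in> {Ms. length Ms = k \<and> set Ms \<subseteq> F}" by auto
  then show ?thesis by blast
qed

lemma norm_growth_image:
  "norm_growth F k = Max ((\<lambda>Ms. onorm ((*v) (mat_prod Ms))) ` {Ms. length Ms = k \<and> set Ms \<subseteq> F})"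
  unfolding norm_growth_def by (rule arg_cong[where f = Max]) auto

lemma norm_growth_le_iff:
  "norm_growth F k \<le> c \<longleftrightarrow>
    (\<forall>Ms. length Ms = k \<and> set Ms \<subseteq> F \<longrightarrow> onorm ((*v) (mat_prod Ms)) \<le> c)"
  using finite_words words_nonempty by (auto simp: norm_growth_image)

lemma norm_growth_nonneg: "0 \<le> norm_growth F k"
proof -
  obtain Ms where "length Ms = k" "set Ms \<subseteq> F" using words_nonempty by blast
  then have "onorm ((*v) (mat_prod Ms)) \<le> norm_growth F k"
    using norm_growth_le_iff by blast
  then show ?thesis
    using onorm_pos_le[OF matrix_vector_mul_bounded_linear[of "mat_prod Ms"]] by simp
qed

lemma norm_growth_submultiplicative:
  "norm_growth F (m + n) \<le> norm_growth F m * norm_growth F n"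
proof (subst norm_growth_le_iff, intro allI impI)
  fix Ms assume Ms: "length Ms = m + n \<and> set Ms \<subseteq> F"
  let ?A = "take m Ms" and ?B = "drop m Ms"
  have A: "onorm ((*v) (mat_prod ?A)) \<le> norm_growth F m"
    using Ms set_take_subset[of m Ms] norm_growth_le_iff[of m "norm_growth F m"] by auto
  have B: "onorm ((*v) (mat_prod ?B)) \<le> norm_growth F n"
    using Ms set_drop_subset[of m Ms] norm_growth_le_iff[of n "norm_growth F n"] by auto
  have "onorm ((*v) (mat_prod Ms)) = onorm ((*v) (mat_prod ?B ** mat_prod ?A))"
    by (simp flip: mat_prod_append)
  also have "\<dots> \<le> onorm ((*v) (mat_prod ?B)) * onorm ((*v) (mat_prod ?A))"
    by (rule onorm_matrix_mult_le)
  also have "\<dots> \<le> norm_growth F n * norm_growth F m"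
    by (intro mult_mono A B norm_growth_nonneg onorm_pos_le matrix_vector_mul_bounded_linear)
  finally show "onorm ((*v) (mat_prod Ms)) \<le> norm_growth F m * norm_growth F n"
    by (simp add: mult.commute)
qed

lemma root_norm_growth_eq:
  assumes "k \<ge> 1"
  shows "Max {root k (onorm ((*v) (mat_prod Ms))) | Ms. length Ms = k \<and> set Ms \<subseteq> F}
    = root k (norm_growth F k)"
proof -
  have "mono (root k)" using assms by (intro monoI) simp
  from mono_Max_commute[OF this, of "(\<lambda>Ms. onorm ((*v) (mat_prod Ms))) ` {Ms. length Ms = k \<and> set Ms \<subseteq> F}"]
  show ?thesis
    using finite_words[of k] words_nonempty[of k]
    by (simp add: norm_growth_image image_image setcompr_eq_image)
qed

text \<open>This turns the \<open>lim\<close> of the definition into a genuine limit: Fekete's lemma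
  gives convergence, and the two sequences agree from index 1 on.\<close>

lemma joint_spectral_radius_LIMSEQ:
  "(\<lambda>k. root k (norm_growth F k)) \<longlonglongrightarrow> joint_spectral_radius F"
proof -
  let ?r = "\<lambda>k. Max {root k (onorm ((*v) (mat_prod Ms))) | Ms. length Ms = k \<and> set Ms \<subseteq> F}"
  have "convergent (\<lambda>k. root k (norm_growth F k))"
    by (intro submultiplicative_root_convergent norm_growth_nonneg norm_growth_submultiplicative)
  then obtain l where l: "(\<lambda>k. root k (norm_growth F k)) \<longlonglongrightarrow> l" by (auto simp: convergent_def)
  have "eventually (\<lambda>k. root k (norm_growth F k) = ?r k) sequentially"
    using eventually_ge_at_top[of 1] by eventually_elim (simp add: root_norm_growth_eq)
  with l have "?r \<longlonglongrightarrow> l" by (rule Lim_transform_eventually)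
  then show ?thesis using l by (simp add: joint_spectral_radius_def limI)
qed

end

section \<open>Stochastic matrices, Dobrushin coefficient and overlap\<close>

lemma row_stochastic_mult:
  assumes "row_stochastic A" "row_stochastic B"
  shows "row_stochastic (A ** B)"
proof -
  have "(\<Sum>j\<in>UNIV. (A ** B) $ i $ j) = 1" for i
  proof -
    have "(\<Sum>j\<in>UNIV. (A ** B) $ i $ j) = (\<Sum>k\<in>UNIV. \<Sum>j\<in>UNIV. A $ i $ k * B $ k $ j)"
      unfolding matrix_matrix_mult_def by (simp, rule sum.swap)
    then show ?thesis
      using assms by (simp add: row_stochastic_def flip: sum_distrib_left)
  qed
  then show ?thesis
    using assms by (auto simp: row_stochastic_def matrix_matrix_mult_def intro!: sum_nonneg)
qed

lemma row_stochastic_mat_1: "row_stochastic (mat 1 :: real^'n^'n)"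
  by (simp add: row_stochastic_def mat_def)

lemma row_stochastic_mat_prod:
  "\<forall>M\<in>set Ms. row_stochastic M \<Longrightarrow> row_stochastic (mat_prod Ms)"
  by (induction Ms) (auto simp: row_stochastic_mat_1 row_stochastic_mult)

lemma dobrushin_le_iff:
  "dobrushin B \<le> t \<longleftrightarrow> (\<forall>x y. (\<Sum>v\<in>UNIV. \<bar>B $ x $ v - B $ y $ v\<bar>) \<le> 2 * t)"
proof -
  let ?S = "{\<Sum>v\<in>UNIV. \<bar>B $ x $ v - B $ y $ v\<bar> | x y. True}"
  have S: "?S = range (\<lambda>(x, y). \<Sum>v\<in>UNIV. \<bar>B $ x $ v - B $ y $ v\<bar>)" by auto
  have "dobrushin B \<le> t \<longleftrightarrow> Max ?S \<le> 2 * t" by (simp add: dobrushin_def mult.commute)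
  also have "\<dots> \<longleftrightarrow> (\<forall>x y. (\<Sum>v\<in>UNIV. \<bar>B $ x $ v - B $ y $ v\<bar>) \<le> 2 * t)"
    unfolding S by (subst Max_le_iff) auto
  finally show ?thesis .
qed

lemma row_difference_le_dobrushin:
  "(\<Sum>v\<in>UNIV. \<bar>B $ x $ v - B $ y $ v\<bar>) \<le> 2 * dobrushin B"
  using dobrushin_le_iff[of B "dobrushin B"] by blast

lemma dobrushin_nonneg: "0 \<le> dobrushin B"
  \<comment> \<open>Any index serves: a row differs from itself by 0.\<close>
  using row_difference_le_dobrushin[of B undefined undefined] by simp

lemma le_overlap_iff:
  "t \<le> overlap B \<longleftrightarrow> (\<forall>x y. t \<le> (\<Sum>v\<in>UNIV. min (B $ x $ v) (B $ y $ v)))"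
proof -
  have S: "{\<Sum>v\<in>UNIV. min (B $ x $ v) (B $ y $ v) | x y. True}
      = range (\<lambda>(x, y). \<Sum>v\<in>UNIV. min (B $ x $ v) (B $ y $ v))" by auto
  show ?thesis unfolding overlap_def S by (subst Min_ge_iff) auto
qed

lemma less_overlap_iff:
  "t < overlap B \<longleftrightarrow> (\<forall>x y. t < (\<Sum>v\<in>UNIV. min (B $ x $ v) (B $ y $ v)))"
proof -
  have S: "{\<Sum>v\<in>UNIV. min (B $ x $ v) (B $ y $ v) | x y. True}
      = range (\<lambda>(x, y). \<Sum>v\<in>UNIV. min (B $ x $ v) (B $ y $ v))" by auto
  show ?thesis unfolding overlap_def S by (subst Min_gr_iff) auto
qed

text \<open>Write min(a, b) as (a + b - |a - b|) / 2 and use that both rows sum to 1.\<close>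

lemma row_stochastic_sum_min:
  assumes "row_stochastic B"
  shows "(\<Sum>v\<in>UNIV. min (B $ x $ v) (B $ y $ v))
    = 1 - (\<Sum>v\<in>UNIV. \<bar>B $ x $ v - B $ y $ v\<bar>) / 2"
proof -
  have "(\<Sum>v\<in>UNIV. min (B $ x $ v) (B $ y $ v))
      = (\<Sum>v\<in>UNIV. (B $ x $ v + B $ y $ v - \<bar>B $ x $ v - B $ y $ v\<bar>) / 2)"
    by (intro sum.cong) auto
  also have "\<dots> = 1 - (\<Sum>v\<in>UNIV. \<bar>B $ x $ v - B $ y $ v\<bar>) / 2"
    using assms
    by (simp add: row_stochastic_def sum.distrib sum_subtractf diff_divide_distrib flip: sum_divide_distrib)
  finally show ?thesis .
qed

lemma overlap_eq_dobrushin: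
  assumes "row_stochastic B"
  shows "overlap B = 1 - dobrushin B"
proof (rule antisym)
  have "dobrushin B \<le> 1 - overlap B"
    using le_overlap_iff[of "overlap B" B]
    by (subst dobrushin_le_iff) (auto simp: row_stochastic_sum_min[OF assms] field_simps)
  then show "overlap B \<le> 1 - dobrushin B" by simp
  show "1 - dobrushin B \<le> overlap B"
    using row_difference_le_dobrushin[of B]
    by (auto simp: le_overlap_iff row_stochastic_sum_min[OF assms] mult.commute)
qed

text \<open>A sum of nonnegative terms is positive iff some term is, and a minimum is positive iff
  both entries are.\<close>

lemma scrambling_iff_overlap:
  assumes "row_stochastic B"
  shows "scrambling B \<longleftrightarrow> 0 < overlap B"
proof -
  have "0 < (\<Sum>v\<in>UNIV. min (B $ x $ v) (B $ y $ v)) \<longleftrightarrow> (\<exists>v. 0 < B $ x $ v \<and> 0 < B $ y $ v)" for x y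
  proof -
    have nn: "0 \<le> min (B $ x $ v) (B $ y $ v)" for v
      using assms by (simp add: row_stochastic_def)
    have "0 < (\<Sum>v\<in>UNIV. min (B $ x $ v) (B $ y $ v)) \<longleftrightarrow> (\<exists>v. min (B $ x $ v) (B $ y $ v) \<noteq> 0)"
      using nn sum_nonneg[of UNIV "\<lambda>v. min (B $ x $ v) (B $ y $ v)"]
      by (simp add: less_le sum_nonneg_eq_0_iff eq_commute[of 0])
    also have "\<dots> \<longleftrightarrow> (\<exists>v. 0 < min (B $ x $ v) (B $ y $ v))"
      using nn by (metis less_le)
    finally show ?thesis by simp
  qed
  then show ?thesis by (simp add: scrambling_def less_overlap_iff)
qed

lemma scrambling_iff_dobrushin:
  "row_stochastic B \<Longrightarrow> scrambling B \<longleftrightarrow> dobrushin B < 1"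
  by (simp add: scrambling_iff_overlap overlap_eq_dobrushin)

text \<open>Splitting d into positive and negative parts of equal mass t writes the image of d as
  a combination of row differences with total weight t.\<close>
lemma zero_sum_image_le_dobrushin:
  fixes d :: "'n::finite \<Rightarrow> real" and B :: "real^'n^'n"
  assumes zero: "(\<Sum>u\<in>UNIV. d u) = 0"
  shows "(\<Sum>v\<in>UNIV. \<bar>\<Sum>u\<in>UNIV. d u * B $ u $ v\<bar>) \<le> (\<Sum>u\<in>UNIV. \<bar>d u\<bar>) * dobrushin B"
proof -
  define p m where "p u = max (d u) 0" and "m u = max (- d u) 0" for u
  define t where "t = (\<Sum>u\<in>UNIV. p u)"
  have d: "d u = p u - m u" and abs_d: "\<bar>d u\<bar> = p u + m u" for u by (auto simp: p_def m_def)
  have pm: "0 \<le> p u" "0 \<le> m u" for u by (auto simp: p_def m_def)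
  have m: "(\<Sum>u\<in>UNIV. m u) = t" using zero by (simp add: d sum_subtractf t_def)
  have abs_sum: "(\<Sum>u\<in>UNIV. \<bar>d u\<bar>) = 2 * t"
    by (simp add: abs_d sum.distrib m t_def[symmetric])
  have t: "0 \<le> t" unfolding t_def by (intro sum_nonneg pm)
  \<comment> \<open>The weights \<open>p u * m w\<close> form the product coupling of the two parts,
    of total mass \<open>t * t\<close>. Keeping the factor \<open>t\<close> on the left avoids
    dividing before \<open>t = 0\<close> is treated separately.\<close>
  have split: "t * (\<Sum>u\<in>UNIV. d u * B $ u $ v)
      = (\<Sum>u\<in>UNIV. \<Sum>w\<in>UNIV. p u * m w * (B $ u $ v - B $ w $ v))" for v
  proof -
    have "(\<Sum>u\<in>UNIV. \<Sum>w\<in>UNIV. p u * m w * (B $ u $ v - B $ w $ v))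
        = (\<Sum>u\<in>UNIV. \<Sum>w\<in>UNIV. (p u * B $ u $ v) * m w)
        - (\<Sum>u\<in>UNIV. \<Sum>w\<in>UNIV. p u * (m w * B $ w $ v))"
      by (simp add: algebra_simps sum_subtractf)
    also have "\<dots> = (\<Sum>u\<in>UNIV. p u * B $ u $ v) * t - t * (\<Sum>w\<in>UNIV. m w * B $ w $ v)"
      by (simp add: m t_def flip: sum_product)
    also have "\<dots> = t * (\<Sum>u\<in>UNIV. d u * B $ u $ v)"
      by (simp add: d algebra_simps sum_subtractf)
    finally show ?thesis by simp
  qed
  have "t * (\<Sum>v\<in>UNIV. \<bar>\<Sum>u\<in>UNIV. d u * B $ u $ v\<bar>)
      = (\<Sum>v\<in>UNIV. \<bar>\<Sum>u\<in>UNIV. \<Sum>w\<in>UNIV. p u * m w * (B $ u $ v - B $ w $ v)\<bar>)"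
    unfolding split[symmetric] abs_mult abs_of_nonneg[OF t] by (rule sum_distrib_left)
  also have "\<dots> \<le> (\<Sum>v\<in>UNIV. \<Sum>u\<in>UNIV. \<Sum>w\<in>UNIV. p u * m w * \<bar>B $ u $ v - B $ w $ v\<bar>)"
  proof (intro sum_mono order_trans[OF sum_abs])
    fix v u w
    show "\<bar>p u * m w * (B $ u $ v - B $ w $ v)\<bar> \<le> p u * m w * \<bar>B $ u $ v - B $ w $ v\<bar>"
      using pm[of u] pm[of w] by (simp add: abs_mult)
  qed
  also have "\<dots> = (\<Sum>u\<in>UNIV. \<Sum>v\<in>UNIV. \<Sum>w\<in>UNIV. p u * m w * \<bar>B $ u $ v - B $ w $ v\<bar>)"
    by (rule sum.swap)
  also have "\<dots> = (\<Sum>u\<in>UNIV. \<Sum>w\<in>UNIV. p u * m w * (\<Sum>v\<in>UNIV. \<bar>B $ u $ v - B $ w $ v\<bar>))"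
    unfolding sum_distrib_left by (intro sum.cong refl sum.swap)
  also have "\<dots> \<le> (\<Sum>u\<in>UNIV. \<Sum>w\<in>UNIV. p u * m w * (2 * dobrushin B))"
    by (intro sum_mono mult_left_mono row_difference_le_dobrushin mult_nonneg_nonneg pm)
  also have "\<dots> = t * (2 * t * dobrushin B)"
    by (simp add: m t_def flip: sum_distrib_right sum_product)
  finally have le: "t * (\<Sum>v\<in>UNIV. \<bar>\<Sum>u\<in>UNIV. d u * B $ u $ v\<bar>) \<le> t * (2 * t * dobrushin B)" .
  show ?thesis
  proof (cases "t = 0")
    case True
    then have "d u = 0" for u
      using abs_sum by (simp add: sum_nonneg_eq_0_iff)
    then show ?thesis by simp
  next
    case False
    then show ?thesis using le t by (simp add: abs_sum)
  qed
qed

text \<open>The difference of two rows of \<open>A\<close> sums to zero, so its image under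
  \<open>B\<close> contracts by \<open>dobrushin B\<close>.\<close>

lemma dobrushin_mult_le:
  fixes A B :: "real^'n^'n"
  assumes "row_stochastic A"
  shows "dobrushin (A ** B) \<le> dobrushin A * dobrushin B"
proof (subst dobrushin_le_iff, intro allI)
  fix x y
  have "(\<Sum>v\<in>UNIV. \<bar>(A ** B) $ x $ v - (A ** B) $ y $ v\<bar>)
      = (\<Sum>v\<in>UNIV. \<bar>\<Sum>u\<in>UNIV. (A $ x $ u - A $ y $ u) * B $ u $ v\<bar>)"
    by (simp add: matrix_matrix_mult_def algebra_simps sum_subtractf)
  also have "\<dots> \<le> (\<Sum>u\<in>UNIV. \<bar>A $ x $ u - A $ y $ u\<bar>) * dobrushin B"
    using assms by (intro zero_sum_image_le_dobrushin) (simp add: row_stochastic_def sum_subtractf)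
  also have "\<dots> \<le> 2 * dobrushin A * dobrushin B"
    by (intro mult_right_mono row_difference_le_dobrushin dobrushin_nonneg)
  finally show "(\<Sum>v\<in>UNIV. \<bar>(A ** B) $ x $ v - (A ** B) $ y $ v\<bar>) \<le> 2 * (dobrushin A * dobrushin B)"
    by simp
qed

text \<open>Phrased for sublevel sets so that \<open>hull_minimal\<close> extends a bound from
  generators to their convex hull.\<close>

lemma convex_dobrushin_le: "convex {B. dobrushin B \<le> t}"
proof (rule convexI)
  fix A B :: "real^'a^'a" and a b :: real
  assume AB: "A \<in> {B. dobrushin B \<le> t}" "B \<in> {B. dobrushin B \<le> t}"
    and ab: "0 \<le> a" "0 \<le> b" "a + b = 1"
  let ?C = "a *\<^sub>R A + b *\<^sub>R B"
  have "(\<Sum>v\<in>UNIV. \<bar>?C $ x $ v - ?C $ y $ v\<bar>) \<le> 2 * t" for x y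
  proof -
    have "(\<Sum>v\<in>UNIV. \<bar>?C $ x $ v - ?C $ y $ v\<bar>)
        \<le> (\<Sum>v\<in>UNIV. a * \<bar>A $ x $ v - A $ y $ v\<bar> + b * \<bar>B $ x $ v - B $ y $ v\<bar>)"
    proof (rule sum_mono)
      fix v
      have "?C $ x $ v - ?C $ y $ v = a * (A $ x $ v - A $ y $ v) + b * (B $ x $ v - B $ y $ v)"
        by (simp add: algebra_simps)
      then show "\<bar>?C $ x $ v - ?C $ y $ v\<bar> \<le> a * \<bar>A $ x $ v - A $ y $ v\<bar> + b * \<bar>B $ x $ v - B $ y $ v\<bar>"
        using ab abs_triangle_ineq[of "a * (A $ x $ v - A $ y $ v)" "b * (B $ x $ v - B $ y $ v)"]
        by (simp add: abs_mult)
    qed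
    also have "\<dots> = a * (\<Sum>v\<in>UNIV. \<bar>A $ x $ v - A $ y $ v\<bar>) + b * (\<Sum>v\<in>UNIV. \<bar>B $ x $ v - B $ y $ v\<bar>)"
      by (simp add: sum.distrib sum_distrib_left)
    also have "\<dots> \<le> a * (2 * t) + b * (2 * t)"
      using AB ab by (intro add_mono mult_left_mono) (auto simp: dobrushin_le_iff)
    also have "\<dots> = 2 * t" using ab by (simp flip: distrib_right)
    finally show ?thesis .
  qed
  then show "?C \<in> {B. dobrushin B \<le> t}" by (simp add: dobrushin_le_iff)
qed

section \<open>Centering, and its norm against the Dobrushin coefficient\<close>

lemma centering_nth: "(centering :: real^'n^'n) $ i $ j = (if i = j then 1 else 0) - 1 / real CARD('n)"
  by (simp add: centering_def mat_def)

lemma centering_mult_nth: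
  fixes B :: "real^'n^'n"
  shows "(centering ** B) $ x $ v = B $ x $ v - (\<Sum>y\<in>UNIV. B $ y $ v) / real CARD('n)"
proof -
  have "(centering ** B) $ x $ v
      = (\<Sum>y\<in>UNIV. (if x = y then B $ y $ v else 0) - B $ y $ v / real CARD('n))"
    unfolding matrix_matrix_mult_def by (auto simp: centering_nth left_diff_distrib intro!: sum.cong)
  then show ?thesis by (simp add: sum_subtractf sum_divide_distrib)
qed

lemma row_stochastic_mult_centering_nth:
  fixes B :: "real^'n^'n"
  assumes "row_stochastic B"
  shows "(B ** centering) $ x $ v = B $ x $ v - 1 / real CARD('n)"
proof -
  have "(B ** centering) $ x $ v
      = (\<Sum>y\<in>UNIV. (if y = v then B $ x $ y else 0) - B $ x $ y / real CARD('n))"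
    unfolding matrix_matrix_mult_def by (auto simp: centering_nth right_diff_distrib intro!: sum.cong)
  then show ?thesis
    using assms by (simp add: sum_subtractf row_stochastic_def flip: sum_divide_distrib)
qed

text \<open>Since the rows of \<open>B\<close> sum to 1, centering on the right subtracts the matrix
  with all entries 1/n. Its columns are constant, so centering on the left removes it.\<close>

lemma centering_row_stochastic_centering:
  fixes B :: "real^'n^'n"
  assumes "row_stochastic B"
  shows "centering ** B ** centering = centering ** B"
proof -
  have "(centering ** (B ** centering)) $ x $ v = (centering ** B) $ x $ v" for x v
    by (simp add: centering_mult_nth row_stochastic_mult_centering_nth[OF assms] sum_subtractf
        diff_divide_distrib)
  then show ?thesis by (simp add: vec_eq_iff matrix_mul_assoc)
qed

text \<open>Left centering subtracts the same column means from every row and so preserves row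
  differences. Each of the n entries of such a difference is at most twice the norm, and the factor
  1/2 of the coefficient cancels the 2.\<close>

lemma dobrushin_le_onorm_centering:
  fixes B :: "real^'n^'n"
  shows "dobrushin B \<le> real CARD('n) * onorm ((*v) (centering ** B))"
proof (subst dobrushin_le_iff, intro allI)
  fix x y
  let ?M = "centering ** B"
  have "(\<Sum>v\<in>UNIV. \<bar>B $ x $ v - B $ y $ v\<bar>) = (\<Sum>v\<in>UNIV. \<bar>?M $ x $ v - ?M $ y $ v\<bar>)"
    by (simp add: centering_mult_nth)
  also have "\<dots> \<le> (\<Sum>v\<in>(UNIV :: 'n set). 2 * onorm ((*v) ?M))"
  proof (rule sum_mono)
    fix v
    show "\<bar>?M $ x $ v - ?M $ y $ v\<bar> \<le> 2 * onorm ((*v) ?M)"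
      using abs_component_le_onorm_matrix[of ?M x v] abs_component_le_onorm_matrix[of ?M y v] by linarith
  qed
  finally show "(\<Sum>v\<in>UNIV. \<bar>B $ x $ v - B $ y $ v\<bar>) \<le> 2 * (real CARD('n) * onorm ((*v) ?M))"
    by simp
qed

text \<open>An entry of the centered matrix is the average over \<open>y\<close> of
  \<open>B $ x $ v - B $ y $ v\<close>, hence at most \<open>2 * dobrushin B\<close> in absolute
  value. The crude entrywise norm bound contributes the square of n.\<close>

lemma onorm_centering_le_dobrushin:
  fixes B :: "real^'n^'n"
  shows "onorm ((*v) (centering ** B)) \<le> 2 * real CARD('n) ^ 2 * dobrushin B"
proof -
  have "\<bar>(centering ** B) $ x $ v\<bar> \<le> 2 * dobrushin B" for x v
  proof -
    have "(centering ** B) $ x $ v = (\<Sum>y\<in>UNIV. B $ x $ v - B $ y $ v) / real CARD('n)"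
      by (simp add: centering_mult_nth sum_subtractf field_simps)
    also have "\<bar>\<dots>\<bar> \<le> (\<Sum>y\<in>(UNIV :: 'n set). 2 * dobrushin B) / real CARD('n)"
    proof -
      have "\<bar>B $ x $ v - B $ y $ v\<bar> \<le> 2 * dobrushin B" for y
        using member_le_sum[of v UNIV "\<lambda>v. \<bar>B $ x $ v - B $ y $ v\<bar>"]
          row_difference_le_dobrushin[of B x y] by simp
      then have "\<bar>\<Sum>y\<in>UNIV. B $ x $ v - B $ y $ v\<bar> \<le> (\<Sum>y\<in>(UNIV :: 'n set). 2 * dobrushin B)"
        by (intro order_trans[OF sum_abs] sum_mono)
      then show ?thesis by (simp add: divide_simps mult.commute)
    qed
    finally show ?thesis by simp
  qed
  then have "onorm ((*v) (centering ** B)) \<le> real CARD('n) * real CARD('n) * (2 * dobrushin B)"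
    by (intro onorm_le_matrix_component)
  then show ?thesis by (simp add: power2_eq_square)
qed

section \<open>Stochastic policies as mixtures of deterministic ones\<close>

lemma stochastic_policy_one_hot: "stochastic_policy (one_hot \<pi>)"
  by (simp add: stochastic_policy_def one_hot_def)

lemma row_stochastic_policy_mat:
  assumes "stochastic_policy \<mu>"
  shows "row_stochastic (policy_mat \<mu>)"
proof -
  have "(\<Sum>y\<in>UNIV. policy_mat \<mu> $ s $ y) = (policy_mat \<mu> *v 1) $ s" for s
    by (simp add: matrix_vector_mult_def)
  then show ?thesis
    using assms by (auto simp: row_stochastic_def policy_mat_mult_vec stochastic_policy_def)
      (simp add: policy_mat_def)
qed

text \<open>A stochastic policy is the mixture of deterministic ones obtained by drawing the actions of
  the different states independently.\<close>
lemma stochastic_policy_mixture: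
  fixes \<mu> :: "'s::finite \<Rightarrow> 'a::finite \<Rightarrow> real"
  assumes "stochastic_policy \<mu>"
  obtains w :: "('s \<Rightarrow> 'a) \<Rightarrow> real"
  where "\<And>\<pi>. 0 \<le> w \<pi>" "sum w UNIV = 1" "\<And>s a. (\<Sum>\<pi>\<in>UNIV. w \<pi> * one_hot \<pi> s a) = \<mu> s a"
proof
  define w where "w \<pi> = (\<Prod>s\<in>UNIV. \<mu> s (\<pi> s))" for \<pi>
  have mu: "0 \<le> \<mu> s a" "(\<Sum>a\<in>UNIV. \<mu> s a) = 1" for s a
    using assms by (auto simp: stochastic_policy_def)
  have expand: "(\<Prod>s\<in>UNIV. \<Sum>a\<in>UNIV. f s a) = (\<Sum>\<pi>\<in>UNIV. \<Prod>s\<in>UNIV. f s (\<pi> s))"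
    for f :: "'s \<Rightarrow> 'a \<Rightarrow> real"
    using prod_sum_PiE[of "UNIV :: 's set" "\<lambda>_. UNIV :: 'a set" f] by (simp add: PiE_UNIV_domain)
  show "0 \<le> w \<pi>" for \<pi> by (simp add: w_def prod_nonneg mu)
  show "sum w UNIV = 1" using expand[of \<mu>] by (simp add: w_def mu)
  fix s a
  \<comment> \<open>The indicator of \<open>\<pi> s = a\<close> is absorbed into the factor at
    \<open>s\<close>. After exchanging sum and product, that factor becomes \<open>\<mu> s a\<close>
    and every other state contributes total probability 1.\<close>
  have "(\<Sum>\<pi>\<in>UNIV. w \<pi> * one_hot \<pi> s a)
      = (\<Sum>\<pi>\<in>UNIV. \<Prod>s'\<in>UNIV. \<mu> s' (\<pi> s') * (if s' = s then if \<pi> s' = a then 1 else 0 else 1))"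
    by (intro sum.cong) (auto simp: w_def prod.distrib one_hot_def)
  also have "\<dots> = (\<Prod>s'\<in>UNIV. \<Sum>b\<in>UNIV. \<mu> s' b * (if s' = s then if b = a then 1 else 0 else 1))"
    by (rule expand[symmetric])
  also have "\<dots> = (\<Prod>s'\<in>UNIV. if s' = s then \<mu> s a else 1)"
  proof (intro prod.cong refl)
    fix s'
    show "(\<Sum>b\<in>UNIV. \<mu> s' b * (if s' = s then if b = a then 1 else 0 else 1))
        = (if s' = s then \<mu> s a else 1)"
      by (simp add: mu if_distrib[of "(*) _"] cong: if_cong)
  qed
  also have "\<dots> = \<mu> s a" by simp
  finally show "(\<Sum>\<pi>\<in>UNIV. w \<pi> * one_hot \<pi> s a) = \<mu> s a" .
qed

text \<open>The kernel is linear in the policy, so a mixture of policies gives the same mixture of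
  kernels.\<close>

lemma sa_kernel_in_hull:
  fixes P :: "real^'s^('s::finite \<times> 'a::finite)"
  assumes "stochastic_policy \<mu>"
  shows "sa_kernel P \<mu> \<in> convex hull (range (\<lambda>\<pi>. sa_kernel P (one_hot \<pi>)))"
proof -
  obtain w :: "('s \<Rightarrow> 'a) \<Rightarrow> real" where w: "\<And>\<pi>. 0 \<le> w \<pi>" "sum w UNIV = 1"
    "\<And>s a. (\<Sum>\<pi>\<in>UNIV. w \<pi> * one_hot \<pi> s a) = \<mu> s a"
    using stochastic_policy_mixture[OF assms] by blast
  have "(\<Sum>\<pi>\<in>UNIV. w \<pi> *\<^sub>R policy_mat (one_hot \<pi>)) = policy_mat \<mu>"
    by (simp add: vec_eq_iff policy_mat_def sum_component w(3))
  moreover have "linear (\<lambda>M. P ** M)"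
    by (intro linearI) (auto simp: matrix_add_ldistrib matrix_scalar_ac scalar_matrix_assoc)
  ultimately have "sa_kernel P \<mu> = (\<Sum>\<pi>\<in>UNIV. w \<pi> *\<^sub>R sa_kernel P (one_hot \<pi>))"
    unfolding sa_kernel_def by (metis (mono_tags, lifting) linear_cmul linear_sum sum.cong)
  also have "\<dots> \<in> convex hull (range (\<lambda>\<pi>. sa_kernel P (one_hot \<pi>)))"
    by (intro convex_sum convex_convex_hull hull_inc) (auto simp: w)
  finally show ?thesis .
qed

text \<open>Matrix multiplication is bilinear: with one factor fixed it is a linear map, which
  commutes with taking convex hulls. This is applied once per factor.\<close>

lemma matrix_mult_in_hull:
  fixes S T U :: "(real^'n^'n) set"
  assumes "A \<in> convex hull S" "B \<in> convex hull T"
    and "\<And>M N. M \<in> S \<Longrightarrow> N \<in> T \<Longrightarrow> M ** N \<in> U"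
  shows "A ** B \<in> convex hull U"
proof -
  have lin_left: "linear (\<lambda>M. M ** N)" and lin_right: "linear (\<lambda>M. N ** M)" for N :: "real^'n^'n"
    by (auto intro!: linearI simp: matrix_matrix_mult_def vec_eq_iff algebra_simps sum.distrib
        sum_distrib_left)
  have "M ** B \<in> convex hull U" if "M \<in> S" for M
  proof -
    have "M ** B \<in> convex hull ((\<lambda>N. M ** N) ` T)"
      using assms(2) by (simp flip: convex_hull_linear_image[OF lin_right])
    also have "\<dots> \<subseteq> convex hull U" using assms(3) that by (intro hull_mono) auto
    finally show ?thesis .
  qed
  then have "convex hull ((\<lambda>M. M ** B) ` S) \<subseteq> convex hull U"
    by (intro hull_minimal convex_convex_hull) auto
  then show ?thesis
    using assms(1) by (auto simp flip: convex_hull_linear_image[OF lin_left])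
qed

text \<open>The policies at different times are mixed independently, so expanding the product factor
  by factor gives deterministic words of the same length. Equal length is what lets the third and
  fourth conditions share their \<open>L\<close>.\<close>

lemma kernel_prod_in_hull:
  fixes P :: "real^'s^('s::finite \<times> 'a::finite)"
  assumes "\<forall>\<mu>\<in>set \<mu>s. stochastic_policy \<mu>"
  shows "kernel_prod P \<mu>s \<in> convex hull (det_kernel_prod P ` {\<omega>. length \<omega> = length \<mu>s})"
  using assms
proof (induction \<mu>s)
  case Nil
  show ?case by (intro hull_inc) (auto simp: det_kernel_prod_def kernel_prod_def)
next
  case (Cons \<mu> \<mu>s)
  have "kernel_prod P \<mu>s ** sa_kernel P \<mu>
      \<in> convex hull (det_kernel_prod P ` {\<omega>. length \<omega> = length (\<mu> # \<mu>s)})"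
  proof (rule matrix_mult_in_hull)
    show "kernel_prod P \<mu>s \<in> convex hull (det_kernel_prod P ` {\<omega>. length \<omega> = length \<mu>s})"
      using Cons by simp
    show "sa_kernel P \<mu> \<in> convex hull (range (\<lambda>\<pi>. sa_kernel P (one_hot \<pi>)))"
      using Cons.prems by (intro sa_kernel_in_hull) simp
    fix M N
    assume "M \<in> det_kernel_prod P ` {\<omega>. length \<omega> = length \<mu>s}"
      and "N \<in> range (\<lambda>\<pi>. sa_kernel P (one_hot \<pi>))"
    then obtain \<omega> \<pi> where "length \<omega> = length \<mu>s" "M = det_kernel_prod P \<omega>" "N = sa_kernel P (one_hot \<pi>)"
      by auto
    then show "M ** N \<in> det_kernel_prod P ` {\<omega>. length \<omega> = length (\<mu> # \<mu>s)}"
      by (intro image_eqI[of _ _ "\<pi> # \<omega>"]) (auto simp: det_kernel_prod_def kernel_prod_def)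
  qed
  then show ?case by (simp add: kernel_prod_def)
qed

lemma dobrushin_kernel_prod_le:
  fixes P :: "real^'s^('s::finite \<times> 'a::finite)"
  assumes "\<forall>\<mu>\<in>set \<mu>s. stochastic_policy \<mu>"
    and "\<And>\<omega>. length \<omega> = length \<mu>s \<Longrightarrow> dobrushin (det_kernel_prod P \<omega>) \<le> t"
  shows "dobrushin (kernel_prod P \<mu>s) \<le> t"
proof -
  have "convex hull (det_kernel_prod P ` {\<omega>. length \<omega> = length \<mu>s}) \<subseteq> {B. dobrushin B \<le> t}"
    using assms(2) by (intro hull_minimal convex_dobrushin_le) auto
  then show ?thesis using kernel_prod_in_hull[OF assms(1), of P] by auto
qed

section \<open>Extrema over policy words of fixed length\<close>

lemma finite_policy_words: "finite {\<omega> :: ('s::finite \<Rightarrow> 'a::finite) list. length \<omega> = L}"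
  using finite_lists_length_eq[of "UNIV :: ('s \<Rightarrow> 'a) set" L] by simp

lemma policy_words_nonempty: "{\<omega> :: ('s::finite \<Rightarrow> 'a::finite) list. length \<omega> = L} \<noteq> {}"
  by (simp add: Ex_list_of_length)

lemma Max_dobrushin_less_iff:
  fixes P :: "real^'s^('s::finite \<times> 'a::finite)"
  shows "Max {dobrushin (det_kernel_prod P \<omega>) | \<omega>. length \<omega> = L} < c
    \<longleftrightarrow> (\<forall>\<omega>. length \<omega> = L \<longrightarrow> dobrushin (det_kernel_prod P \<omega>) < c)"
  unfolding setcompr_eq_image using finite_policy_words[of L] policy_words_nonempty[of L]
  by (subst Max_less_iff) auto

text \<open>The supremum is attained: one-hot policies put the finite set \<open>D\<close> inside
  \<open>S\<close>, and convexity bounds \<open>S\<close> by \<open>Max D\<close>. A strict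
  pointwise bound on deterministic words therefore stays strict.\<close>

lemma Sup_dobrushin_less_iff:
  fixes P :: "real^'s^('s::finite \<times> 'a::finite)"
  shows "Sup {dobrushin (kernel_prod P \<mu>s) | \<mu>s.
      length \<mu>s = L \<and> (\<forall>\<mu>\<in>set \<mu>s. stochastic_policy \<mu>)} < c
    \<longleftrightarrow> (\<forall>\<omega>. length \<omega> = L \<longrightarrow> dobrushin (det_kernel_prod P \<omega>) < c)"
proof -
  define S where "S = {dobrushin (kernel_prod P \<mu>s) | \<mu>s.
      length \<mu>s = L \<and> (\<forall>\<mu>\<in>set \<mu>s. stochastic_policy \<mu>)}"
  define D where "D = {dobrushin (det_kernel_prod P \<omega>) | \<omega>. length \<omega> = L}"
  have D: "finite D" "D \<noteq> {}"
    using finite_policy_words[of L] policy_words_nonempty[of L]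
    unfolding D_def setcompr_eq_image by auto
  have "D \<subseteq> S"
  proof
    fix x assume "x \<in> D"
    then obtain \<omega> where "length \<omega> = L" "x = dobrushin (det_kernel_prod P \<omega>)"
      unfolding D_def by blast
    then show "x \<in> S"
      unfolding S_def det_kernel_prod_def
      by (intro CollectI exI[of _ "map one_hot \<omega>"]) (auto simp: stochastic_policy_one_hot)
  qed
  moreover have upper: "x \<le> Max D" if x: "x \<in> S" for x
  proof -
    obtain \<mu>s where \<mu>s: "x = dobrushin (kernel_prod P \<mu>s)" "length \<mu>s = L"
      "\<forall>\<mu>\<in>set \<mu>s. stochastic_policy \<mu>" using x unfolding S_def by blast
    have "dobrushin (det_kernel_prod P \<omega>) \<le> Max D" if "length \<omega> = length \<mu>s" for \<omega>
      by (rule Max_ge[OF D(1)]) (use that \<mu>s(2) in \<open>auto simp: D_def\<close>)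
    then show ?thesis unfolding \<mu>s(1) by (rule dobrushin_kernel_prod_le[OF \<mu>s(3)])
  qed
  ultimately have "Sup S = Max D"
    using Max_in[OF D] by (intro cSup_eq_maximum) auto
  then have "Sup S < c \<longleftrightarrow> Max D < c" by simp
  then show ?thesis unfolding S_def D_def Max_dobrushin_less_iff .
qed

lemma eta_less_iff:
  fixes P :: "real^'s^('s::finite \<times> 'a::finite)"
  shows "c < eta P L \<longleftrightarrow> (\<forall>\<omega>. length \<omega> = L \<longrightarrow> c < overlap (det_kernel_prod P \<omega>))"
  unfolding eta_def setcompr_eq_image using finite_policy_words[of L] policy_words_nonempty[of L]
  by (subst Min_gr_iff) auto

lemma eta_le_overlap:
  fixes P :: "real^'s^('s::finite \<times> 'a::finite)"
  assumes "length \<omega> = L"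
  shows "eta P L \<le> overlap (det_kernel_prod P \<omega>)"
  unfolding eta_def using assms finite_policy_words[of L] by (intro Min_le) (auto simp: setcompr_eq_image)

section \<open>The restricted family and its joint spectral radius\<close>

context
  fixes P :: "real^'s^('s::finite \<times> 'a::finite)"
  assumes P: "row_stochastic P"
begin

lemma row_stochastic_sa_kernel: "stochastic_policy \<mu> \<Longrightarrow> row_stochastic (sa_kernel P \<mu>)"
  unfolding sa_kernel_def by (intro row_stochastic_mult P row_stochastic_policy_mat)

lemma row_stochastic_det_kernel_prod: "row_stochastic (det_kernel_prod P \<omega>)"
  unfolding det_kernel_prod_def kernel_prod_def
  by (intro row_stochastic_mat_prod)
    (auto intro: row_stochastic_sa_kernel stochastic_policy_one_hot)

lemma dobrushin_det_kernel_prod_power: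
  assumes "\<And>\<omega>. length \<omega> = L \<Longrightarrow> dobrushin (det_kernel_prod P \<omega>) \<le> t" and "length \<omega> = j * L" "j \<ge> 1"
  shows "dobrushin (det_kernel_prod P \<omega>) \<le> t ^ j"
  using assms(3,2)
proof (induction j arbitrary: \<omega> rule: nat_induct_at_least)
  case base
  then show ?case using assms(1) by simp
next
  case (Suc j)
  let ?A = "det_kernel_prod P (take L \<omega>)" and ?B = "det_kernel_prod P (drop L \<omega>)"
  have A: "dobrushin ?A \<le> t" and B: "dobrushin ?B \<le> t ^ j"
    using Suc.prems by (auto intro!: assms(1) Suc.IH)
  have t: "0 \<le> t" using A dobrushin_nonneg[of ?A] by simp
  have "det_kernel_prod P \<omega> = ?B ** ?A"
    unfolding det_kernel_prod_def kernel_prod_def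
    by (simp flip: mat_prod_append map_append)
  then have "dobrushin (det_kernel_prod P \<omega>) \<le> dobrushin ?B * dobrushin ?A"
    by (simp add: dobrushin_mult_le row_stochastic_det_kernel_prod)
  also have "\<dots> \<le> t ^ j * t"
    using A B t by (intro mult_mono dobrushin_nonneg) auto
  finally show ?case by (simp add: mult.commute)
qed

context
  fixes \<gamma> :: real
  assumes \<gamma>: "0 < \<gamma>"
begin

lemma restricted_mat_eq:
  "restricted_mat P \<gamma> \<pi> = \<gamma> *\<^sub>R (centering ** sa_kernel P (one_hot \<pi>))"
proof -
  have "restricted_mat P \<gamma> \<pi> = \<gamma> *\<^sub>R (centering ** sa_kernel P (one_hot \<pi>) ** centering)"
    by (simp add: restricted_mat_def matrix_scalar_ac scalar_matrix_assoc)
  then show ?thesis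
    by (simp add: centering_row_stochastic_centering row_stochastic_sa_kernel stochastic_policy_one_hot)
qed

text \<open>Each inner centering has a stochastic product and then another centering to its left, so
  it is absorbed and only the leftmost one remains. The empty word must be excluded: its product is
  the identity, not \<open>centering\<close>.\<close>

lemma restricted_mat_prod:
  assumes "\<omega> \<noteq> []"
  shows "mat_prod (map (restricted_mat P \<gamma>) \<omega>)
    = \<gamma> ^ length \<omega> *\<^sub>R (centering ** det_kernel_prod P \<omega>)"
  using assms
proof (induction \<omega> rule: list_nonempty_induct)
  case (single \<pi>)
  then show ?case by (simp add: restricted_mat_eq det_kernel_prod_def kernel_prod_def)
next
  case (cons \<pi> \<omega>)
  let ?B = "det_kernel_prod P \<omega>" and ?K = "sa_kernel P (one_hot \<pi>)"
  have "mat_prod (map (restricted_mat P \<gamma>) (\<pi> # \<omega>))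
      = (\<gamma> ^ length \<omega> *\<^sub>R (centering ** ?B)) ** (\<gamma> *\<^sub>R (centering ** ?K))"
    by (simp add: cons.IH) (simp add: restricted_mat_eq)
  also have "\<dots> = \<gamma> ^ length (\<pi> # \<omega>) *\<^sub>R (centering ** ?B ** centering ** ?K)"
    by (simp add: matrix_scalar_ac scalar_matrix_assoc matrix_mul_assoc mult.commute)
  also have "centering ** ?B ** centering ** ?K = centering ** det_kernel_prod P (\<pi> # \<omega>)"
    unfolding centering_row_stochastic_centering[OF row_stochastic_det_kernel_prod]
    by (simp add: det_kernel_prod_def kernel_prod_def matrix_mul_assoc)
  finally show ?case .
qed

text \<open>Passes from words of matrices to words of policies. Different policies may give the same
  matrix, but surjectivity suffices for a universally quantified bound.\<close>

lemma norm_growth_restricted_le_iff: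
  assumes "k \<ge> 1"
  shows "norm_growth (range (restricted_mat P \<gamma>)) k \<le> c
    \<longleftrightarrow> (\<forall>\<omega>. length \<omega> = k \<longrightarrow> \<gamma> ^ k * onorm ((*v) (centering ** det_kernel_prod P \<omega>)) \<le> c)"
proof -
  let ?R = "restricted_mat P \<gamma>"
  have onorm_eq: "onorm ((*v) (mat_prod (map ?R \<omega>)))
      = \<gamma> ^ k * onorm ((*v) (centering ** det_kernel_prod P \<omega>))" if "length \<omega> = k" for \<omega>
  proof -
    have "\<omega> \<noteq> []" using that assms by auto
    then have "(*v) (mat_prod (map ?R \<omega>))
        = (\<lambda>x. \<gamma> ^ k *\<^sub>R ((centering ** det_kernel_prod P \<omega>) *v x))"
      using that by (simp add: restricted_mat_prod fun_eq_iff scaleR_matrix_vector_assoc)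
    then show ?thesis
      using \<gamma> by (simp add: onorm_scaleR matrix_vector_mul_bounded_linear)
  qed
  have "norm_growth (range ?R) k \<le> c
      \<longleftrightarrow> (\<forall>Ms. length Ms = k \<and> set Ms \<subseteq> range ?R \<longrightarrow> onorm ((*v) (mat_prod Ms)) \<le> c)"
    by (intro norm_growth_le_iff) auto
  also have "\<dots> \<longleftrightarrow> (\<forall>\<omega>. length \<omega> = k \<longrightarrow> onorm ((*v) (mat_prod (map ?R \<omega>))) \<le> c)"
  proof -
    have "{Ms. length Ms = k \<and> set Ms \<subseteq> range ?R} = map ?R ` {\<omega>. length \<omega> = k}"
    proof -
      have "set Ms \<subseteq> range ?R \<longleftrightarrow> (\<exists>\<omega>. Ms = map ?R \<omega>)" for Ms
        unfolding ex_map_conv by blast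
      then show ?thesis by auto
    qed
    then show ?thesis by (simp add: set_eq_iff image_iff) blast
  qed
  finally show ?thesis using onorm_eq by auto
qed

lemma rho_bar_LIMSEQ:
  "(\<lambda>k. root k (norm_growth (range (restricted_mat P \<gamma>)) k)) \<longlonglongrightarrow> rho_bar P \<gamma>"
  unfolding rho_bar_def by (intro joint_spectral_radius_LIMSEQ) auto

lemma norm_growth_restricted_nonneg: "0 \<le> norm_growth (range (restricted_mat P \<gamma>)) k"
  by (intro norm_growth_nonneg) auto

lemma rho_bar_less_imp_dobrushin:
  assumes "rho_bar P \<gamma> < \<gamma>"
  shows "\<exists>L\<ge>1. \<forall>\<omega>. length \<omega> = L \<longrightarrow> dobrushin (det_kernel_prod P \<omega>) < 1"
proof -
  let ?n = "real CARD('s \<times> 'a)" and ?N = "norm_growth (range (restricted_mat P \<gamma>))"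
  have n: "0 < ?n" by simp
  \<comment> \<open>Norms of long products lie below \<open>c ^ k\<close>; after removing
    \<open>\<gamma> ^ k\<close>, the ratio \<open>c / \<gamma>\<close> below 1 must still beat the
    comparison constant \<open>?n\<close>.\<close>
  obtain c where c: "rho_bar P \<gamma> < c" "c < \<gamma>" using dense assms by blast
  have "0 \<le> rho_bar P \<gamma>"
    by (rule LIMSEQ_le_const[OF rho_bar_LIMSEQ])
      (auto intro!: exI[of _ 1] simp: norm_growth_restricted_nonneg)
  then have c0: "0 < c" using c by simp
  have "(\<lambda>k. (c / \<gamma>) ^ k) \<longlonglongrightarrow> 0"
    using c c0 \<gamma> by (intro LIMSEQ_power_zero) (simp add: field_simps)
  then have "eventually (\<lambda>k. (c / \<gamma>) ^ k < 1 / ?n) sequentially"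
    using n by (intro order_tendstoD(2)) auto
  then have "eventually (\<lambda>k. k \<ge> 1 \<and> root k (?N k) < c \<and> (c / \<gamma>) ^ k < 1 / ?n) sequentially"
    by (intro eventually_conj eventually_ge_at_top order_tendstoD(2)[OF rho_bar_LIMSEQ c(1)])
  then obtain L where L: "L \<ge> 1" "root L (?N L) < c" "(c / \<gamma>) ^ L < 1 / ?n"
    using eventually_happens'[OF sequentially_bot] by blast
  have "root L (?N L) ^ L \<le> c ^ L"
    using L norm_growth_restricted_nonneg[of L] by (intro power_mono) auto
  then have "?N L \<le> c ^ L" using L norm_growth_restricted_nonneg[of L] by simp
  then have bound: "\<gamma> ^ L * onorm ((*v) (centering ** det_kernel_prod P \<omega>)) \<le> c ^ L"
    if "length \<omega> = L" for \<omega>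
    using norm_growth_restricted_le_iff[OF L(1)] that by blast
  have "dobrushin (det_kernel_prod P \<omega>) < 1" if "length \<omega> = L" for \<omega>
  proof -
    have "dobrushin (det_kernel_prod P \<omega>) \<le> ?n * onorm ((*v) (centering ** det_kernel_prod P \<omega>))"
      by (rule dobrushin_le_onorm_centering)
    also have "\<dots> \<le> ?n * (c / \<gamma>) ^ L"
      using bound[OF that] \<gamma> by (intro mult_left_mono) (simp_all add: field_simps)
    also have "\<dots> < ?n * (1 / ?n)" by (intro mult_strict_left_mono L(3) n)
    finally show ?thesis by simp
  qed
  then show ?thesis using L(1) by blast
qed

text \<open>The limit is already known to exist, so it can be computed along multiples of
  \<open>L\<close>, where words split into full blocks and no remainder occurs.\<close>

lemma rho_bar_le_root:
  assumes L: "L \<ge> 1" and t: "\<And>\<omega>. length \<omega> = L \<Longrightarrow> dobrushin (det_kernel_prod P \<omega>) \<le> t"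
  shows "rho_bar P \<gamma> \<le> \<gamma> * root L t"
proof -
  let ?N = "norm_growth (range (restricted_mat P \<gamma>))"
  define K where "K = 2 * real CARD('s \<times> 'a) ^ 2"
  have K: "0 < K" by (simp add: K_def)
  \<comment> \<open>Any word of length \<open>L\<close> witnesses that \<open>t\<close> bounds a
    nonnegative number.\<close>
  have t0: "0 \<le> t"
    using order_trans[OF dobrushin_nonneg t[of "replicate L undefined"]] by simp
  \<comment> \<open>\<open>Suc j\<close> keeps the length positive, as the roots and the block bound
    require.\<close>
  have sub: "strict_mono (\<lambda>j. Suc j * L)" using L by (intro strict_monoI) simp
  have lim: "(\<lambda>j. root (Suc j * L) (?N (Suc j * L))) \<longlonglongrightarrow> rho_bar P \<gamma>"
    using LIMSEQ_subseq_LIMSEQ[OF rho_bar_LIMSEQ sub] by (simp add: o_def)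
  have "(\<lambda>j. root (Suc j * L) K) \<longlonglongrightarrow> 1"
    using LIMSEQ_subseq_LIMSEQ[OF LIMSEQ_root_const[OF K] sub] by (simp add: o_def)
  then have lim': "(\<lambda>j. \<gamma> * root L t * root (Suc j * L) K) \<longlonglongrightarrow> \<gamma> * root L t * 1"
    by (intro tendsto_intros)
  have "root (Suc j * L) (?N (Suc j * L)) \<le> \<gamma> * root L t * root (Suc j * L) K" for j
  proof -
    let ?k = "Suc j * L"
    have k: "?k \<ge> 1" "0 < ?k" using L by simp_all
    have "?N ?k \<le> \<gamma> ^ ?k * (K * t ^ Suc j)"
      unfolding norm_growth_restricted_le_iff[OF k(1)]
    proof (intro allI impI mult_left_mono)
      fix \<omega> :: "('s \<Rightarrow> 'a) list" assume "length \<omega> = ?k"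
      then have "K * dobrushin (det_kernel_prod P \<omega>) \<le> K * t ^ Suc j"
        using K by (intro mult_left_mono dobrushin_det_kernel_prod_power[OF t]) auto
      with onorm_centering_le_dobrushin[of "det_kernel_prod P \<omega>", folded K_def]
      show "onorm ((*v) (centering ** det_kernel_prod P \<omega>)) \<le> K * t ^ Suc j"
        by (rule order_trans)
    qed (use \<gamma> in simp)
    then have "root ?k (?N ?k) \<le> root ?k (\<gamma> ^ ?k * (K * t ^ Suc j))"
      by (rule real_root_le_mono[OF k(2)])
    also have "\<dots> = root ?k (\<gamma> ^ ?k) * (root ?k K * root ?k (t ^ Suc j))"
      by (simp only: real_root_mult)
    also have "root ?k (\<gamma> ^ ?k) = \<gamma>" using \<gamma> by (intro real_root_power_cancel k(2)) simp
    \<comment> \<open>Splitting the root lets its \<open>Suc j\<close> part cancel the number of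
      blocks, which leaves \<open>root L t\<close>.\<close>
    also have "root ?k (t ^ Suc j) = root L (root (Suc j) (t ^ Suc j))"
      by (subst mult.commute) (rule real_root_mult_exp)
    also have "root (Suc j) (t ^ Suc j) = t"
      by (rule real_root_power_cancel[OF zero_less_Suc t0])
    finally show ?thesis by (simp add: mult_ac)
  qed
  then show ?thesis using LIMSEQ_le[OF lim lim'] by auto
qed

text \<open>Every coefficient at length \<open>L\<close> is one minus an overlap, hence at most
  \<open>1 - eta P L\<close>; this is the \<open>t\<close> fed to \<open>rho_bar_le_root\<close>.
  Positivity of \<open>eta\<close> comes from taking a minimum of finitely many positive
  overlaps.\<close>

lemma scrambling_rho_bar_bound:
  assumes L: "L \<ge> 1" and scr: "\<forall>\<omega>. length \<omega> = L \<longrightarrow> scrambling (det_kernel_prod P \<omega>)"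
  shows "0 < eta P L" "rho_bar P \<gamma> \<le> \<gamma> * root L (1 - eta P L)" "\<gamma> * root L (1 - eta P L) < \<gamma>"
proof -
  show eta: "0 < eta P L"
    using scr by (simp add: eta_less_iff scrambling_iff_overlap[OF row_stochastic_det_kernel_prod])
  show "rho_bar P \<gamma> \<le> \<gamma> * root L (1 - eta P L)"
    using eta_le_overlap[of _ L P]
    by (intro rho_bar_le_root L) (auto simp: overlap_eq_dobrushin[OF row_stochastic_det_kernel_prod] algebra_simps)
  show "\<gamma> * root L (1 - eta P L) < \<gamma>" using \<gamma> L eta by simp
qed

end

end

theorem proposition3:
  fixes P :: "real^'s^('s::finite \<times> 'a::finite)" and \<gamma> :: real
  assumes "row_stochastic P" and "0 < \<gamma>" and "\<gamma> < 1"
  shows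
    "(rho_bar P \<gamma> < \<gamma>
        \<longleftrightarrow> (\<exists>L\<ge>1. \<forall>\<omega>. length \<omega> = L \<longrightarrow> scrambling (det_kernel_prod P \<omega>))) \<and>
     (rho_bar P \<gamma> < \<gamma>
        \<longleftrightarrow> (\<exists>L\<ge>1. Max {dobrushin (det_kernel_prod P \<omega>) | \<omega>. length \<omega> = L} < 1)) \<and>
     (rho_bar P \<gamma> < \<gamma>
        \<longleftrightarrow> (\<exists>L\<ge>1. Sup {dobrushin (kernel_prod P \<mu>s) | \<mu>s.
               length \<mu>s = L \<and> (\<forall>\<mu>\<in>set \<mu>s. stochastic_policy \<mu>)} < 1)) \<and>
     (\<forall>L\<ge>1. (\<forall>\<omega>. length \<omega> = L \<longrightarrow> scrambling (det_kernel_prod P \<omega>)) \<longrightarrow>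
        0 < eta P L \<and>
        rho_bar P \<gamma> \<le> \<gamma> * root L (1 - eta P L) \<and>
        \<gamma> * root L (1 - eta P L) < \<gamma>)"
proof -
  have scr: "scrambling (det_kernel_prod P \<omega>) \<longleftrightarrow> dobrushin (det_kernel_prod P \<omega>) < 1" for \<omega>
    by (intro scrambling_iff_dobrushin row_stochastic_det_kernel_prod assms(1))
  note bound = scrambling_rho_bar_bound[OF assms(1,2), unfolded scr]
  have iff: "rho_bar P \<gamma> < \<gamma>
      \<longleftrightarrow> (\<exists>L\<ge>1. \<forall>\<omega>. length \<omega> = L \<longrightarrow> dobrushin (det_kernel_prod P \<omega>) < 1)"
  proof
    assume "rho_bar P \<gamma> < \<gamma>"
    then show "\<exists>L\<ge>1. \<forall>\<omega>. length \<omega> = L \<longrightarrow> dobrushin (det_kernel_prod P \<omega>) < 1"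
      by (rule rho_bar_less_imp_dobrushin[OF assms(1,2)])
  next
    assume "\<exists>L\<ge>1. \<forall>\<omega>. length \<omega> = L \<longrightarrow> dobrushin (det_kernel_prod P \<omega>) < 1"
    then obtain L where "L \<ge> 1" "\<forall>\<omega>. length \<omega> = L \<longrightarrow> dobrushin (det_kernel_prod P \<omega>) < 1"
      by blast
    from bound(2,3)[OF this] show "rho_bar P \<gamma> < \<gamma>" by (rule le_less_trans)
  qed
  \<comment> \<open>After unfolding, the last three conditions are literally the same statement
    about deterministic words, so \<open>iff\<close> settles all the equivalences.\<close>
  show ?thesis
    unfolding scr Max_dobrushin_less_iff Sup_dobrushin_less_iff
    by (intro conjI iff allI impI; rule bound; assumption)
qed

end
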